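(* For all $n\ge 1$, $$\mu_{\widehat{\Pi_n^{w}}}(\hat{0},\hat{1})=(-1)^n(n-1)^{n-1},$$ where $\widehat{\Pi_n^w}=\Pi_n^w\cup\{\hat 1\}$ is the poset of weighted partitions of $\{1,\dots,n\}$ with a maximum element adjoined, and $\mu_{\widehat{\Pi_n^{w}}}$ is its Möbius function.
   Context: Let $[n]=\{1,\dots,n\}$. A weighted partition of $[n]$ is a set $\{B_1^{v_1},\dots,B_t^{v_t}\}$ where $\{B_1,\dots,B_t\}$ is a partition of $[n]$ and $v_i\in\{0,1,\dots,|B_i|-1\}$ for all $i$. The poset $\Pi_n^w$ is the set of weighted partitions of $[n]$ ordered by: $\{A_1^{w_1},\dots,A_s^{w_s}\}\le\{B_1^{v_1},\dots,B_t^{v_t}\}$ iff (a) $\{A_1,\dots,A_s\}$ refines $\{B_1,\dots,B_t\}$, and (b) whenever $B_k=A_{i_1}\cup\cdots\cup A_{i_l}$, then $v_k-(w_{i_1}+\cdots+w_{i_l})\in\{0,1,\dots,l-1\}$. Its minimum element is $\hat 0=\{\{1\}^0,\dots,\{n\}^0\}$. The poset $\widehat{\Pi_n^w}$ is obtained from $\Pi_n^w$ by adjoining a new element $\hat 1$ larger than all others. The convention $0^0=1$ is used. *)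

theory Defs
  imports "HOL-Library.Disjoint_Sets"
begin

text \<open>A poset is given by its order relation \<open>r\<close>, a reflexive one, so that its underlying set
  is \<open>Field r\<close>; \<open>(x, y) \<in> r\<close> means \<open>x \<le> y\<close>.\<close>

definition order_interval :: "'a rel \<Rightarrow> 'a \<Rightarrow> 'a \<Rightarrow> 'a set" where
  "order_interval r x y = {z. (x, z) \<in> r \<and> (z, y) \<in> r}"

text \<open>The guard only serves to make the recursion terminate; outside its scope (and for
  \<open>\<not> x \<le> y\<close>) the value is 0. The usual unguarded equations for a locally finite poset are
  \<open>moebius_refl\<close> and \<open>moebius_less\<close> below.\<close>

function moebius :: "'a rel \<Rightarrow> 'a \<Rightarrow> 'a \<Rightarrow> int" where
  "moebius r x y =
     (if partial_order_on (Field r) r \<and> (x, y) \<in> r \<and> finite (order_interval r x y)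
      then if x = y then 1
           else - (\<Sum>z \<in> order_interval r x y - {y}. moebius r x z)
      else 0)"
  by pat_completeness auto
termination
proof (relation "measure (\<lambda>(r, x, y). card (order_interval r x y))", goal_cases)
  case 1
  show ?case by simp
next
  case (2 r x y z)
  then have tr: "trans r" and an: "antisym r"
    by (auto simp: partial_order_on_def preorder_on_def)
  from 2 have z: "(x, z) \<in> r" "(z, y) \<in> r" "z \<noteq> y"
    by (auto simp: order_interval_def)
  have "order_interval r x z \<subseteq> order_interval r x y"
    using z tr by (auto simp: order_interval_def dest: transD)
  moreover have "y \<in> order_interval r x y"
    using 2 by (auto simp: order_interval_def partial_order_on_def preorder_on_def
        intro: refl_onD FieldI2)
  moreover have "y \<notin> order_interval r x z"
    using z an by (auto simp: order_interval_def dest: antisymD)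
  ultimately have "order_interval r x z \<subset> order_interval r x y"
    by blast
  with 2 show ?case
    by (auto intro: psubset_card_mono)
qed

declare moebius.simps [simp del]

lemma moebius_refl:
  assumes "partial_order_on (Field r) r" "x \<in> Field r"
  shows "moebius r x x = 1"
proof -
  have "(x, x) \<in> r" "antisym r"
    using assms by (auto simp: partial_order_on_def preorder_on_def intro: refl_onD)
  then have "order_interval r x x = {x}"
    by (auto simp: order_interval_def dest: antisymD)
  then show ?thesis
    using assms \<open>(x, x) \<in> r\<close> by (subst moebius.simps) simp
qed

lemma moebius_less:
  assumes "partial_order_on (Field r) r" "(x, y) \<in> r" "x \<noteq> y" "finite (order_interval r x y)"
  shows "moebius r x y = - (\<Sum>z | (x, z) \<in> r \<and> (z, y) \<in> r \<and> z \<noteq> y. moebius r x z)"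
proof -
  have "order_interval r x y - {y} = {z. (x, z) \<in> r \<and> (z, y) \<in> r \<and> z \<noteq> y}"
    by (auto simp: order_interval_def)
  then show ?thesis
    using assms by (subst moebius.simps) simp
qed

text \<open>\<open>None\<close> is the new maximum, \<open>Some x\<close> the old element \<open>x\<close>.\<close>

definition adjoin_top :: "'a rel \<Rightarrow> 'a option rel" where
  "adjoin_top r =
     {(Some x, Some y) | x y. (x, y) \<in> r} \<union> {(Some x, None) | x. x \<in> Field r} \<union> {(None, None)}"

text \<open>A pair \<open>(B, v)\<close> stands for the weighted block \<open>B\<^sup>v\<close>. Injectivity of \<open>fst\<close> says that
  every block carries a single weight.\<close>

definition weighted_partitions :: "nat \<Rightarrow> (nat set \<times> nat) set set" where
  "weighted_partitions n =
     {P. partition_on {1..n} (fst ` P) \<and> inj_on fst P \<and> (\<forall>(B, v) \<in> P. v < card B)}"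

definition blocks_within :: "(nat set \<times> nat) set \<Rightarrow> nat set \<Rightarrow> (nat set \<times> nat) set" where
  "blocks_within P B = {(A, w) \<in> P. A \<subseteq> B}"

text \<open>When \<open>fst ` P\<close> refines \<open>fst ` Q\<close>, the members of \<open>blocks_within P B\<close> are the weighted
  blocks of \<open>P\<close> whose union is the block \<open>B\<close> of \<open>Q\<close>. The difference of the weights is taken
  in \<open>int\<close>, to avoid truncated subtraction.\<close>

definition weighted_partition_order :: "nat \<Rightarrow> (nat set \<times> nat) set rel" where
  "weighted_partition_order n =
     {(P, Q). P \<in> weighted_partitions n \<and> Q \<in> weighted_partitions n \<and>
        refines {1..n} (fst ` P) (fst ` Q) \<and>
        (\<forall>(B, v) \<in> Q. int v - (\<Sum>(A, w) \<in> blocks_within P B. int w)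
            \<in> {0 .. int (card (blocks_within P B)) - 1})}"

definition weighted_partition_bot :: "nat \<Rightarrow> (nat set \<times> nat) set" where
  "weighted_partition_bot n = (\<lambda>i. ({i}, 0)) ` {1..n}"

lemma blocks_within_block:
  assumes P: "P \<in> weighted_partitions n" and B: "(B, v) \<in> P"
  shows "blocks_within P B = {(B, v)}"
proof -
  have part: "partition_on {1..n} (fst ` P)" and inj: "inj_on fst P"
    using P by (auto simp: weighted_partitions_def)
  have "A = B \<and> w = v" if A: "(A, w) \<in> P" "A \<subseteq> B" for A w
  proof -
    have mem: "A \<in> fst ` P" "B \<in> fst ` P"
      using A B by (auto intro: rev_image_eqI)
    have "A \<noteq> {}"
      using partition_onD3[OF part] mem by blast
    then have "A = B"
      using disjointD[OF partition_onD2[OF part] mem] A(2) by blast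
    then show ?thesis
      using inj_onD[OF inj, of "(A, w)" "(B, v)"] A B by simp
  qed
  then show ?thesis
    using B unfolding blocks_within_def by blast
qed

lemma weighted_partition_order_refl:
  assumes P: "P \<in> weighted_partitions n"
  shows "(P, P) \<in> weighted_partition_order n"
proof -
  have "refines {1..n} (fst ` P) (fst ` P)"
    using P by (intro refines_refl) (simp add: weighted_partitions_def)
  then show ?thesis
    using P blocks_within_block[OF P] by (auto simp: weighted_partition_order_def)
qed

lemma Field_weighted_partition_order:
  "Field (weighted_partition_order n) = weighted_partitions n"
proof
  show "Field (weighted_partition_order n) \<subseteq> weighted_partitions n"
    by (auto simp: Field_def weighted_partition_order_def)
  show "weighted_partitions n \<subseteq> Field (weighted_partition_order n)"
    using weighted_partition_order_refl by (auto intro: FieldI1)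
qed

lemma finite_weighted_partitions: "finite (weighted_partitions n)"
proof (rule finite_subset)
  show "weighted_partitions n \<subseteq> Pow (Pow {1..n} \<times> {..n})"
  proof (intro subsetI PowI)
    fix P p assume P: "P \<in> weighted_partitions n" and p: "p \<in> P"
    obtain B v where [simp]: "p = (B, v)" by force
    have "B \<in> fst ` P"
      using p by (auto intro: rev_image_eqI)
    then have B: "B \<subseteq> {1..n}"
      using P by (auto simp: weighted_partitions_def partition_on_def)
    have "v < card B"
      using P p by (auto simp: weighted_partitions_def)
    also have "\<dots> \<le> n"
      using card_mono[OF _ B] by simp
    finally show "p \<in> Pow {1..n} \<times> {..n}"
      using B by simp
  qed
qed auto

lemma weighted_partition_order_antisym:
  assumes PQ: "(P, Q) \<in> weighted_partition_order n" and QP: "(Q, P) \<in> weighted_partition_order n"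
  shows "P = Q"
proof -
  have sub: "P \<subseteq> Q" if "(P, Q) \<in> weighted_partition_order n" "(Q, P) \<in> weighted_partition_order n"
    for P Q
  proof
    fix p assume p: "p \<in> P"
    obtain B v where [simp]: "p = (B, v)" by force
    have eq: "fst ` P = fst ` Q"
      using that by (auto simp: weighted_partition_order_def intro!: refines_asym)
    have "B \<in> fst ` Q"
      unfolding eq[symmetric] using p by (auto intro: rev_image_eqI)
    then obtain u where u: "(B, u) \<in> Q" by auto
    have P: "P \<in> weighted_partitions n" and Q: "Q \<in> weighted_partitions n"
      using that by (auto simp: weighted_partition_order_def)
    have wt: "int b - (\<Sum>(A, w) \<in> blocks_within S B. int w)
        \<in> {0 .. int (card (blocks_within S B)) - 1}"
      if "(S, T) \<in> weighted_partition_order n" "(B, b) \<in> T" for S T b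
      using that unfolding weighted_partition_order_def by blast
    have v: "(B, v) \<in> P" using p by simp
    have "u = v"
      using wt[OF that(1) u] wt[OF that(2) v]
      unfolding blocks_within_block[OF P v] blocks_within_block[OF Q u] by simp
    then show "p \<in> Q" using u by simp
  qed
  show ?thesis using sub[OF PQ QP] sub[OF QP PQ] by blast
qed

lemma weighted_partition_order_trans:
  assumes PQ: "(P, Q) \<in> weighted_partition_order n" and QR: "(Q, R) \<in> weighted_partition_order n"
  shows "(P, R) \<in> weighted_partition_order n"
proof -
  have P: "P \<in> weighted_partitions n" and Q: "Q \<in> weighted_partitions n"
    and R: "R \<in> weighted_partitions n"
    and ref: "refines {1..n} (fst ` P) (fst ` Q)" "refines {1..n} (fst ` Q) (fst ` R)"
    using PQ QR unfolding weighted_partition_order_def by blast+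
  have fin: "finite S" if "S \<in> weighted_partitions n" for S
  proof -
    have "finite (fst ` S)" "inj_on fst S"
      using that finite_elements[of "{1..n}" "fst ` S"] by (auto simp: weighted_partitions_def)
    then show ?thesis by (rule finite_imageD)
  qed
  have "int u - (\<Sum>(A, w) \<in> blocks_within P C. int w) \<in> {0 .. int (card (blocks_within P C)) - 1}"
    if C: "(C, u) \<in> R" for C u
  proof -
    let ?T = "blocks_within Q C" and ?S = "\<lambda>b. blocks_within P (fst b)"
    have finQ: "finite ?T" and finP: "finite (blocks_within P B)" for B
      using finite_subset[OF _ fin[OF P]] finite_subset[OF _ fin[OF Q]]
      by (simp_all add: blocks_within_def subset_iff)
    have ne: "A \<noteq> {}" if "(A, w) \<in> P" for A w
      using P that by (force simp: weighted_partitions_def)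
    have disjQ: "fst b \<inter> fst c = {}" if "b \<in> Q" "c \<in> Q" "b \<noteq> c" for b c
    proof -
      have "fst b \<noteq> fst c"
        using Q that by (auto simp: weighted_partitions_def dest: inj_onD)
      then show ?thesis
        using Q that by (auto simp: weighted_partitions_def partition_on_def disjoint_def)
    qed
    have un: "blocks_within P C = (\<Union>b\<in>?T. ?S b)"
    proof
      show "(\<Union>b\<in>?T. ?S b) \<subseteq> blocks_within P C"
        by (fastforce simp: blocks_within_def)
      show "blocks_within P C \<subseteq> (\<Union>b\<in>?T. ?S b)"
      proof
        fix a assume a: "a \<in> blocks_within P C"
        obtain A w where [simp]: "a = (A, w)" by force
        have A: "(A, w) \<in> P" "A \<subseteq> C" using a by (auto simp: blocks_within_def)
        then have "A \<in> fst ` P" by (auto intro: rev_image_eqI)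
        then obtain b where b: "b \<in> Q" "A \<subseteq> fst b"
          using ref(1) by (auto simp: refines_def)
        then obtain D where D: "D \<in> fst ` R" "fst b \<subseteq> D"
          using ref(2) unfolding refines_def by blast
        have "C \<in> fst ` R" using C by (auto intro: rev_image_eqI)
        moreover have "D \<inter> C \<noteq> {}"
          using ne[OF A(1)] A(2) b D by auto
        ultimately have "D = C"
          using R D(1) by (auto simp: weighted_partitions_def partition_on_def disjoint_def)
        then have "b \<in> ?T" using b D by (auto simp: blocks_within_def)
        moreover have "a \<in> ?S b" using A b by (auto simp: blocks_within_def)
        ultimately show "a \<in> (\<Union>b\<in>?T. ?S b)" by blast
      qed
    qed
    have disj: "\<forall>b\<in>?T. \<forall>c\<in>?T. b \<noteq> c \<longrightarrow> ?S b \<inter> ?S c = {}"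
    proof (intro ballI impI equals0I)
      fix b c a assume bc: "b \<in> ?T" "c \<in> ?T" "b \<noteq> c" and a: "a \<in> ?S b \<inter> ?S c"
      obtain A w where [simp]: "a = (A, w)" by force
      have "A \<subseteq> fst b \<inter> fst c" "(A, w) \<in> P" using a by (auto simp: blocks_within_def)
      moreover have "fst b \<inter> fst c = {}"
        using bc by (intro disjQ) (auto simp: blocks_within_def)
      ultimately show False using ne by blast
    qed
    have sum_un: "(\<Sum>(A, w) \<in> blocks_within P C. int w) = (\<Sum>b\<in>?T. \<Sum>(A, w) \<in> ?S b. int w)"
      unfolding un using finQ finP disj by (intro sum.UNION_disjoint) auto
    have card_un: "int (card (blocks_within P C)) = (\<Sum>b\<in>?T. int (card (?S b)))"
      unfolding un using finQ finP disj by (subst card_UN_disjoint) auto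
    have loc: "int (snd b) - (\<Sum>(A, w) \<in> ?S b. int w) \<in> {0 .. int (card (?S b)) - 1}"
      if "b \<in> ?T" for b
    proof -
      have "(fst b, snd b) \<in> Q" using that by (auto simp: blocks_within_def)
      then show ?thesis using PQ unfolding weighted_partition_order_def by blast
    qed
    have lo: "(\<Sum>b\<in>?T. \<Sum>(A, w) \<in> ?S b. int w) \<le> (\<Sum>b\<in>?T. int (snd b))"
      using loc by (intro sum_mono) force
    have "(\<Sum>b\<in>?T. int (snd b)) \<le> (\<Sum>b\<in>?T. (\<Sum>(A, w) \<in> ?S b. int w) + int (card (?S b)) - 1)"
      using loc by (intro sum_mono) force
    then have hi: "(\<Sum>b\<in>?T. int (snd b)) \<le>
        (\<Sum>b\<in>?T. \<Sum>(A, w) \<in> ?S b. int w) + (\<Sum>b\<in>?T. int (card (?S b))) - int (card ?T)"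
      by (simp add: sum.distrib sum_subtractf)
    have "int u - (\<Sum>(A, w) \<in> ?T. int w) \<in> {0 .. int (card ?T) - 1}"
      using QR C unfolding weighted_partition_order_def by blast
    moreover have "(\<Sum>(A, w) \<in> ?T. int w) = (\<Sum>b\<in>?T. int (snd b))"
      by (simp add: case_prod_beta)
    ultimately show ?thesis
      using lo hi unfolding sum_un card_un by auto
  qed
  then show ?thesis
    using P R refines_trans[OF ref] unfolding weighted_partition_order_def by blast
qed

lemma partial_order_weighted_partition_order:
  "partial_order_on (weighted_partitions n) (weighted_partition_order n)"
proof -
  have "weighted_partition_order n \<subseteq> weighted_partitions n \<times> weighted_partitions n"
    by (auto simp: weighted_partition_order_def)
  moreover have "refl_on (weighted_partitions n) (weighted_partition_order n)"
    by (auto intro: refl_onI weighted_partition_order_refl)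
  moreover have "trans (weighted_partition_order n)"
    by (rule transI) (rule weighted_partition_order_trans)
  moreover have "antisym (weighted_partition_order n)"
    by (rule antisymI) (rule weighted_partition_order_antisym)
  ultimately show ?thesis
    by (simp add: partial_order_on_def preorder_on_def)
qed

lemma weighted_partition_bot_least:
  assumes Q: "Q \<in> weighted_partitions n"
  shows "(weighted_partition_bot n, Q) \<in> weighted_partition_order n"
proof -
  have fst_bot: "fst ` weighted_partition_bot n = (\<lambda>i. {i}) ` {1..n}"
    by (auto simp: weighted_partition_bot_def image_image)
  have bot: "weighted_partition_bot n \<in> weighted_partitions n"
    using partition_on_singletons[of "{1..n}"] unfolding weighted_partitions_def fst_bot[symmetric]
    by (auto simp: weighted_partition_bot_def inj_on_def)
  have part: "partition_on {1..n} (fst ` Q)"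
    using Q by (simp add: weighted_partitions_def)
  have "\<exists>Y\<in>fst ` Q. X \<subseteq> Y" if "X \<in> fst ` weighted_partition_bot n" for X
    using that partition_onD1[OF part] unfolding fst_bot by blast
  then have ref: "refines {1..n} (fst ` weighted_partition_bot n) (fst ` Q)"
    using bot part by (simp add: refines_def weighted_partitions_def)
  have "int v - (\<Sum>(A, w) \<in> blocks_within (weighted_partition_bot n) B. int w)
      \<in> {0 .. int (card (blocks_within (weighted_partition_bot n) B)) - 1}"
    if B: "(B, v) \<in> Q" for B v
  proof -
    have "B \<in> fst ` Q" using B by (auto intro: rev_image_eqI)
    then have "B \<subseteq> {1..n}" using partition_onD1[OF part] by blast
    then have eq: "blocks_within (weighted_partition_bot n) B = (\<lambda>i. ({i}, 0)) ` B"
      by (auto simp: blocks_within_def weighted_partition_bot_def)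
    have "card ((\<lambda>i. ({i}, 0 :: nat)) ` B) = card B"
      by (rule card_image) (auto simp: inj_on_def)
    moreover have "(\<Sum>(A, w) \<in> (\<lambda>i. ({i}, 0 :: nat)) ` B. int w) = 0"
      by (rule sum.neutral) auto
    moreover have "v < card B" using Q B by (auto simp: weighted_partitions_def)
    ultimately show ?thesis unfolding eq by simp
  qed
  then show ?thesis
    using bot Q ref unfolding weighted_partition_order_def by blast
qed

lemma Field_adjoin_top: "Field (adjoin_top r) = insert None (Some ` Field r)"
  by (auto simp: adjoin_top_def Field_def)

lemma partial_order_adjoin_top:
  assumes "partial_order_on (Field r) r"
  shows "partial_order_on (Field (adjoin_top r)) (adjoin_top r)"
proof -
  have r: "refl_on (Field r) r" "trans r" "antisym r"
    using assms by (auto simp: partial_order_on_def preorder_on_def)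
  have "adjoin_top r \<subseteq> Field (adjoin_top r) \<times> Field (adjoin_top r)"
    by (auto intro: FieldI1 FieldI2)
  moreover have "refl_on (Field (adjoin_top r)) (adjoin_top r)"
    using r(1) unfolding Field_adjoin_top by (auto simp: refl_on_def adjoin_top_def)
  moreover have "trans (adjoin_top r)"
  proof (rule transI)
    fix x y z assume "(x, y) \<in> adjoin_top r" "(y, z) \<in> adjoin_top r"
    then show "(x, z) \<in> adjoin_top r"
      using transD[OF r(2)] by (fastforce simp: adjoin_top_def Field_def)
  qed
  moreover have "antisym (adjoin_top r)"
  proof (rule antisymI)
    fix x y assume "(x, y) \<in> adjoin_top r" "(y, x) \<in> adjoin_top r"
    then show "x = y"
      using antisymD[OF r(3)] by (fastforce simp: adjoin_top_def)
  qed
  ultimately show ?thesis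
    by (simp add: partial_order_on_def preorder_on_def)
qed

lemma partial_order_weighted_partition_hat:
  "partial_order_on (Field (adjoin_top (weighted_partition_order n)))
     (adjoin_top (weighted_partition_order n))"
  using partial_order_weighted_partition_order
  by (intro partial_order_adjoin_top) (simp add: Field_weighted_partition_order)

lemma finite_interval_weighted_partition_hat:
  "finite (order_interval (adjoin_top (weighted_partition_order n)) x y)"
proof (rule finite_subset)
  show "order_interval (adjoin_top (weighted_partition_order n)) x y
      \<subseteq> Field (adjoin_top (weighted_partition_order n))"
    by (auto simp: order_interval_def intro: FieldI2)
  show "finite (Field (adjoin_top (weighted_partition_order n)))"
    by (simp add: Field_adjoin_top Field_weighted_partition_order finite_weighted_partitions)
qed

end

theory Submission
  imports Defs "HOL-Library.FuncSet"
begin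

text \<open>The value is found from the other end of the poset. The elements above a weighted partition
  with \<open>k\<close> blocks correspond to the weighted partitions of its set of blocks, so \<open>\<mu>(\<cdot>, 1)\<close> depends on
  \<open>k\<close> only; it suffices to guess \<open>(-1)^k (k-1)^(k-1)\<close> and to check that it satisfies the recursion
  for \<open>\<mu>(\<cdot>, 1)\<close>. Choosing a weight for a block amounts to choosing a point of it, hence there are
  \<open>(m choose k) k^(m-k)\<close> weighted partitions of an \<open>m\<close>-set with \<open>k\<close> blocks, and the recursion becomes
  a special case of Abel's binomial theorem.\<close>

section \<open>Binomial sums and Abel's identity\<close>

text \<open>Up to sign this is the \<open>m\<close>-th finite difference of a polynomial of degree
  \<open>d\<close>, which vanishes for \<open>d < m\<close>. Pascal's rule peels off one difference:
  the sum for \<open>Suc m\<close> at \<open>c\<close> is the sum for \<open>m\<close> at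
  \<open>c\<close> minus the sum for \<open>m\<close> at \<open>c + 1\<close>.\<close>

lemma alternating_sum_power_eq_0:
  fixes c :: "'a::comm_ring_1"
  assumes "d < m"
  shows "(\<Sum>k\<le>m. (-1) ^ k * of_nat (m choose k) * (of_nat k + c) ^ d) = 0"
  using assms
proof (induction m arbitrary: c d)
  case (Suc m)
  let ?S = "\<lambda>d c. \<Sum>k\<le>m. (-1) ^ k * of_nat (m choose k) * (of_nat k + c) ^ d"
  have "(\<Sum>k\<le>Suc m. (-1) ^ k * of_nat (Suc m choose k) * (of_nat k + c) ^ d)
      = c ^ d + (\<Sum>k\<le>m. (-1) ^ Suc k * of_nat (Suc m choose Suc k) * (of_nat (Suc k) + c) ^ d)"
    by (subst sum.atMost_Suc_shift) simp
  also have "\<dots> = c ^ d + (\<Sum>k\<le>m. (-1) ^ Suc k * of_nat (m choose Suc k) * (of_nat (Suc k) + c) ^ d)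
      - ?S d (c + 1)"
    by (simp add: sum.distrib sum_subtractf sum_negf algebra_simps)
  also have "c ^ d + (\<Sum>k\<le>m. (-1) ^ Suc k * of_nat (m choose Suc k) * (of_nat (Suc k) + c) ^ d)
      = (\<Sum>k\<le>Suc m. (-1) ^ k * of_nat (m choose k) * (of_nat k + c) ^ d)"
    by (subst sum.atMost_Suc_shift) simp
  also have "\<dots> = ?S d c"
    by (simp add: binomial_eq_0)
  also have "?S d (c + 1) = (\<Sum>i\<le>d. of_nat (d choose i) * ?S i c)"
  proof -
    have "(of_nat k + (c + 1)) ^ d = (\<Sum>i\<le>d. of_nat (d choose i) * (of_nat k + c) ^ i)" for k
      using binomial_ring[of "of_nat k + c" 1 d] by (simp add: add.assoc)
    then show ?thesis
      by (simp only: sum_distrib_left, subst sum.swap) (simp add: mult_ac)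
  qed
  \<comment> \<open>Each \<open>i < d\<close> satisfies \<open>i < m\<close>, so the induction
    hypothesis removes it. The term \<open>i = d\<close> may have \<open>d = m\<close> and is out of
    its reach, but it cancels against the other \<open>?S d c\<close>.\<close>
  also have "\<dots> = ?S d c"
  proof -
    have "(\<Sum>i\<le>d. of_nat (d choose i) * ?S i c) = (\<Sum>i\<in>{d}. of_nat (d choose i) * ?S i c)"
      using Suc by (intro sum.mono_neutral_right) auto
    then show ?thesis by simp
  qed
  finally show ?case by simp
qed simp

lemma sum_Pow_card:
  fixes h :: "nat \<Rightarrow> 'b::comm_semiring_1"
  assumes "finite S"
  shows "(\<Sum>K\<in>Pow S. h (card K)) = (\<Sum>k\<le>card S. of_nat (card S choose k) * h k)"
proof -
  have "(\<Sum>K\<in>Pow S. h (card K)) = (\<Sum>k\<le>card S. \<Sum>K\<in>{K \<in> Pow S. card K = k}. h (card K))"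
    using assms by (intro sum.group[symmetric]) (auto intro: card_mono)
  also have "\<dots> = (\<Sum>k\<le>card S. of_nat (card {K. K \<subseteq> S \<and> card K = k}) * h k)"
    by (intro sum.cong) auto
  finally show ?thesis
    using assms by (simp add: n_subsets)
qed

text \<open>Abel's identity \<open>\<Sum>k\<le>n. (n choose k) x (x + k)^(k-1) (y - k)^(n-k) = (x + y)^n\<close>
  at \<open>x = -1\<close>, \<open>y = 0\<close>. At \<open>k = 0\<close> the truncated exponent \<open>k - 1\<close> is harmless, the factor
  \<open>0^n\<close> being zero.\<close>

lemma abel_sum:
  assumes "n > 0"
  shows "(\<Sum>k\<le>n. int (n choose k) * (int k ^ (n - k) * ((-1) ^ k * (int k - 1) ^ (k - 1)))) = -1"
proof -
  \<comment> \<open>The sum over all \<open>k \<le> m\<close> is zero by the preceding lemma with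
    \<open>d = m - 1\<close> and \<open>c = -1\<close>; what remains is minus the term at
    \<open>k = 0\<close>.\<close>
  have vanish: "(\<Sum>k\<in>{1..m}. (-1) ^ k * int (m choose k) * (int k - 1) ^ (m - 1)) = (-1) ^ m"
    if "m > 0" for m
  proof -
    have "0 = (\<Sum>k\<le>m. (-1) ^ k * int (m choose k) * (int k - 1) ^ (m - 1))"
      using alternating_sum_power_eq_0[of "m - 1" m "-1::int"] that by simp
    also have "{..m} = insert 0 {1..m}" by auto
    finally have "(\<Sum>k\<in>{1..m}. (-1) ^ k * int (m choose k) * (int k - 1) ^ (m - 1))
        = - ((-1) ^ (m - 1))"
      by simp
    also have "\<dots> = (-1) ^ m" using that by (cases m) auto
    finally show ?thesis .
  qed
  have "(\<Sum>k\<le>n. int (n choose k) * (int k ^ (n - k) * ((-1) ^ k * (int k - 1) ^ (k - 1))))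
     = (\<Sum>k\<in>{1..n}. int (n choose k) * (int k ^ (n - k) * ((-1) ^ k * (int k - 1) ^ (k - 1))))"
    using assms by (intro sum.mono_neutral_right) (auto simp: not_less_eq_eq)
  also have "\<dots> = (\<Sum>k\<in>{1..n}. \<Sum>m\<in>{k..n}.
      int (n choose m) * ((-1) ^ k * int (m choose k) * (int k - 1) ^ (m - 1)))"
  proof (rule sum.cong[OF refl])
    fix k assume k: "k \<in> {1..n}"
    \<comment> \<open>Writing \<open>k\<close> as \<open>(k - 1) + 1\<close> leaves only powers of
      \<open>k - 1\<close>. With \<open>m = i + k\<close> the exponents add up to
      \<open>(m - k) + (k - 1) = m - 1\<close>, using \<open>k \<ge> 1\<close>, and the binomials
      regroup as \<open>(n choose m) * (m choose k)\<close>. Once the sums are swapped, the inner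
      one is that of \<open>vanish\<close>.\<close>
    have "int k ^ (n - k) = (\<Sum>i\<le>n-k. int (n - k choose i) * (int k - 1) ^ i)"
      using binomial_ring[of "int k - 1" 1 "n - k"] by simp
    also have "\<dots> = (\<Sum>m\<in>{k..n}. int (n - k choose (m - k)) * (int k - 1) ^ (m - k))"
      using k by (intro sum.reindex_bij_witness[of _ "\<lambda>m. m - k" "\<lambda>i. i + k"]) auto
    finally have "int (n choose k) * (int k ^ (n - k) * ((-1) ^ k * (int k - 1) ^ (k - 1)))
       = (\<Sum>m\<in>{k..n}. int ((n choose k) * (n - k choose (m - k)))
          * ((-1) ^ k * ((int k - 1) ^ (m - k) * (int k - 1) ^ (k - 1))))"
      by (simp add: sum_distrib_left sum_distrib_right mult_ac)
    also have "\<dots> = (\<Sum>m\<in>{k..n}. int ((n choose m) * (m choose k))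
          * ((-1) ^ k * (int k - 1) ^ (m - 1)))"
      using k by (intro sum.cong refl arg_cong2[of _ _ _ _ "(*)"])
        (auto simp: choose_mult simp flip: power_add)
    finally show "int (n choose k) * (int k ^ (n - k) * ((-1) ^ k * (int k - 1) ^ (k - 1))) =
       (\<Sum>m\<in>{k..n}. int (n choose m) * ((-1) ^ k * int (m choose k) * (int k - 1) ^ (m - 1)))"
      by (simp add: mult_ac)
  qed
  also have "\<dots> = (\<Sum>m\<in>{1..n}. \<Sum>k\<in>{1..m}.
      int (n choose m) * ((-1) ^ k * int (m choose k) * (int k - 1) ^ (m - 1)))"
    by (subst (1 2) sum.Sigma) (auto intro!: sum.reindex_bij_witness[of _ prod.swap prod.swap])
  also have "\<dots> = (\<Sum>m\<in>{1..n}. int (n choose m) * (-1) ^ m)"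
    by (rule sum.cong) (auto simp: sum_distrib_left[symmetric] vanish[unfolded One_nat_def])
  \<comment> \<open>The full alternating sum of binomials is zero, so the missing term at
    \<open>m = 0\<close> supplies the value -1.\<close>
  also have "\<dots> = (\<Sum>m\<le>n. (-1) ^ m * int (n choose m)) - 1"
  proof -
    have "{..n} = insert 0 {1..n}" by auto
    then show ?thesis by (simp add: mult_ac)
  qed
  also have "\<dots> = -1"
    using choose_alternating_sum[OF assms, where 'a = int] by simp
  finally show ?thesis .
qed

section \<open>Moebius values from the dual recursion\<close>

text \<open>Evaluate \<open>\<Sum>x\<le>z. \<mu>(b, x) g(z)\<close> by summing first over \<open>z\<close> and then over \<open>x\<close>, and conversely:
  the left inverse \<open>\<mu>(b, \<cdot>)\<close> of the zeta function meets its right inverse \<open>g\<close>.\<close>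

lemma moebius_eq_of_dual_recursion:
  assumes po: "partial_order_on (Field r) r" and fin: "finite (Field r)"
    and bot: "\<And>x. x \<in> Field r \<Longrightarrow> (b, x) \<in> r" and b: "b \<in> Field r"
    and top: "\<And>x. x \<in> Field r \<Longrightarrow> (x, t) \<in> r" and t: "t \<in> Field r"
    and g_top: "g t = 1"
    and g: "\<And>x. x \<in> Field r \<Longrightarrow> x \<noteq> t \<Longrightarrow> (\<Sum>z | (x, z) \<in> r. g z) = 0"
  shows "moebius r b t = g b"
proof -
  have refl: "(x, x) \<in> r" if "x \<in> Field r" for x
    using po that by (auto simp: partial_order_on_def preorder_on_def intro: refl_onD)
  have antisym: "antisym r"
    using po by (auto simp: partial_order_on_def)
  have fin_r: "finite {z. (x, z) \<in> r}" "finite {z. (z, x) \<in> r}" for x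
    using fin by (auto intro: finite_subset[of _ "Field r"] FieldI1 FieldI2)
  \<comment> \<open>As \<open>b\<close> is least, everything below \<open>z\<close> is the interval
    from \<open>b\<close> to \<open>z\<close>, so the defining recursion says that this sum is zero
    unless \<open>z = b\<close>.\<close>
  have mu: "(\<Sum>x | (x, z) \<in> r. moebius r b x) = (if z = b then 1 else 0)" if z: "z \<in> Field r" for z
  proof (cases "z = b")
    case True
    have "{x. (x, b) \<in> r} = {b}"
      using bot refl b antisym by (auto dest: antisymD intro: FieldI1)
    then show ?thesis using True moebius_refl[OF po b] by simp
  next
    case False
    have "{x. (x, z) \<in> r} = insert z {x. (b, x) \<in> r \<and> (x, z) \<in> r \<and> x \<noteq> z}"
      using bot refl z by (auto intro: FieldI1)
    moreover have "finite {x. (b, x) \<in> r \<and> (x, z) \<in> r \<and> x \<noteq> z}"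
      by (rule finite_subset[OF _ fin_r(2)[of z]]) auto
    moreover have "moebius r b z = - (\<Sum>x | (b, x) \<in> r \<and> (x, z) \<in> r \<and> x \<noteq> z. moebius r b x)"
      using False bot z fin_r by (intro moebius_less po)
        (auto simp: order_interval_def intro: finite_subset[OF _ fin_r(2)[of z]])
    ultimately show ?thesis using False by simp
  qed
  have dual: "(\<Sum>z | (x, z) \<in> r. g z) = (if x = t then 1 else 0)" if x: "x \<in> Field r" for x
  proof (cases "x = t")
    case True
    have "{z. (t, z) \<in> r} = {t}"
      using top refl t antisym by (auto dest: antisymD intro: FieldI2)
    then show ?thesis using True g_top by simp
  qed (use g x in auto)
  have "moebius r b t = (\<Sum>x\<in>Field r. moebius r b x * (if x = t then 1 else 0))"
    using fin t by (simp add: if_distrib[of "(*) _"] cong: if_cong)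
  also have "\<dots> = (\<Sum>x\<in>Field r. \<Sum>z | (x, z) \<in> r. moebius r b x * g z)"
    by (rule sum.cong) (simp_all only: dual sum_distrib_left[of "moebius r b _" g, symmetric])
  also have "\<dots> = (\<Sum>z\<in>Field r. \<Sum>x | (x, z) \<in> r. moebius r b x * g z)"
    using fin fin_r by (subst (1 2) sum.Sigma)
      (auto intro!: sum.reindex_bij_witness[of _ prod.swap prod.swap] simp: Field_def)
  also have "\<dots> = (\<Sum>z\<in>Field r. (if z = b then 1 else 0) * g z)"
    by (rule sum.cong) (simp_all only: mu sum_distrib_right[symmetric])
  also have "\<dots> = g b"
    using fin b by (simp add: if_distrib[of "\<lambda>x. x * _"] cong: if_cong)
  finally show ?thesis .
qed


section \<open>Counting weighted partitions of a finite set\<close>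

text \<open>The ground type is arbitrary because the ground set will later be a weighted partition
  \<open>P\<close> itself, with its weighted blocks as points.\<close>

definition weighted_partitions_on :: "'a set \<Rightarrow> ('a set \<times> nat) set set" where
  "weighted_partitions_on S =
     {P. partition_on S (fst ` P) \<and> inj_on fst P \<and> (\<forall>(B, v) \<in> P. v < card B)}"

lemma weighted_partitions_eq: "weighted_partitions n = weighted_partitions_on {1..n}"
  by (simp add: weighted_partitions_def weighted_partitions_on_def)

text \<open>Disjointness of the blocks and uniqueness of their weights merge into one condition: a
  single weighted block passes through each point. Blocks are nonempty because their size exceeds
  some weight.\<close>

lemma weighted_partitions_on_iff:
  "P \<in> weighted_partitions_on S \<longleftrightarrow>
     (\<forall>p\<in>P. fst p \<subseteq> S \<and> snd p < card (fst p)) \<and> (\<forall>x\<in>S. \<exists>!p. p \<in> P \<and> x \<in> fst p)"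
  (is "?L \<longleftrightarrow> ?R")
proof
  assume L: ?L
  then have part: "partition_on S (fst ` P)" and inj: "inj_on fst P"
    and wt: "\<And>p. p \<in> P \<Longrightarrow> snd p < card (fst p)"
    by (auto simp: weighted_partitions_on_def)
  have "p = q" if "p \<in> P" "q \<in> P" "x \<in> fst p" "x \<in> fst q" for p q x
    using disjointD[OF partition_onD2[OF part], of "fst p" "fst q"] that inj
    by (auto dest: inj_onD)
  then show ?R
    using wt partition_onD1[OF part] by blast
next
  assume R: ?R
  then have eq: "p = q" if "p \<in> P" "q \<in> P" "x \<in> fst p" "x \<in> fst q" for p q x
    using that by blast
  have ne: "fst p \<noteq> {}" if "p \<in> P" for p
    using R that by fastforce
  have "partition_on S (fst ` P)"
  proof (rule partition_onI)
    show "\<Union> (fst ` P) = S" using R by blast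
    show "disjnt B C" if "B \<in> fst ` P" "C \<in> fst ` P" "B \<noteq> C" for B C
      using that eq by (auto simp: disjnt_def) (metis fst_conv)+
  qed (use ne in auto)
  moreover have "inj_on fst P"
    using eq ne by (intro inj_onI) (metis all_not_in_conv)
  ultimately show ?L
    using R by (auto simp: weighted_partitions_on_def)
qed

lemma weighted_partition_unique:
  assumes "P \<in> weighted_partitions_on S" "p \<in> P" "q \<in> P" "x \<in> fst p" "x \<in> fst q"
  shows "p = q"
  using assms unfolding weighted_partitions_on_iff by blast

lemma weighted_partition_finite:
  assumes "P \<in> weighted_partitions_on S" "finite S"
  shows "finite P"
  using assms finite_elements[of S "fst ` P"]
  by (auto simp: weighted_partitions_on_def intro: finite_imageD)

text \<open>Sizes of disjoint blocks add up, and each size is at least the weight plus one. Hence,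
  when the blocks in \<open>C\<close> are united, an excess below \<open>card C\<close> keeps the
  total weight below the size of the union.\<close>

lemma weighted_partition_sum_le:
  assumes P: "P \<in> weighted_partitions_on S" and S: "finite S" and C: "C \<subseteq> P"
  shows "card C + sum snd C \<le> card (\<Union> (fst ` C))"
proof -
  have fin: "finite C" using weighted_partition_finite[OF P S] C by (rule finite_subset[rotated])
  have "card (\<Union> (fst ` C)) = (\<Sum>p\<in>C. card (fst p))"
  proof (rule card_UN_disjoint)
    show "\<forall>p\<in>C. finite (fst p)"
      using P C S by (auto simp: weighted_partitions_on_iff intro: finite_subset)
    show "\<forall>p\<in>C. \<forall>q\<in>C. p \<noteq> q \<longrightarrow> fst p \<inter> fst q = {}"
      using weighted_partition_unique[OF P] C by blast
  qed (fact fin)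
  moreover have "(\<Sum>p\<in>C. snd p + 1) \<le> (\<Sum>p\<in>C. card (fst p))"
    using P C by (intro sum_mono) (auto simp: weighted_partitions_on_iff Suc_le_eq)
  moreover have "(\<Sum>p\<in>C. snd p + 1) = card C + sum snd C"
    by (subst sum.distrib) simp
  ultimately show ?thesis by linarith
qed

text \<open>\<open>K\<close> is the set of the chosen points of the blocks, and \<open>f\<close> sends every other point to the
  chosen point of its block.\<close>

lemma weighted_partitions_on_bij:
  assumes S: "finite S"
  obtains F where "bij_betw F (SIGMA K:Pow S. (S - K) \<rightarrow>\<^sub>E K) (weighted_partitions_on S)"
    and "\<And>K f. card (F (K, f)) = card K"
proof -
  have "\<exists>h. bij_betw h B {0..<card B}" if "finite B" for B :: "'a set"
    using ex_bij_betw_finite_nat[OF that] .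
  \<comment> \<open>\<open>e B\<close> is an arbitrary numbering of \<open>B\<close> from 0; it
    turns a chosen point of \<open>B\<close> into an admissible weight.\<close>
  then obtain e :: "'a set \<Rightarrow> 'a \<Rightarrow> nat"
    where e: "\<And>B. finite B \<Longrightarrow> bij_betw (e B) B {0..<card B}" by metis
  define block where "block K f r = insert r {x \<in> S - K. f x = r}" for K f and r :: 'a
  define F where "F = (\<lambda>(K, f). (\<lambda>r. (block K f r, e (block K f r) r)) ` K)"
  \<comment> \<open>A block thus determines its chosen point, which gives both the cardinality of
    \<open>F (K, f)\<close> and the recovery of \<open>f\<close>.\<close>
  have Int: "block K f r \<inter> K = {r}" if "r \<in> K" for K f r
    using that by (auto simp: block_def)
  have fin: "finite (block K f r)" for K f r
    using S by (simp add: block_def)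
  \<comment> \<open>The inverse translation, from a weight to the chosen point; applied to
    \<open>F (K, f)\<close> it recovers \<open>K\<close>.\<close>
  define root where "root p = inv_into (fst p) (e (fst p)) (snd p)" for p
  have root: "root (B, e B x) = x" if "finite B" "x \<in> B" for B x
    using e[OF that(1)] that(2) by (simp add: root_def bij_betw_def)
  have root_F: "root ` F (K, f) = K" for K f
  proof -
    have "root (block K f r, e (block K f r) r) = r" for r
      using fin[of K f r] by (rule root) (simp add: block_def)
    then show ?thesis by (simp add: F_def image_image)
  qed
  have "card (F (K, f)) = card K" for K f
    unfolding F_def prod.case
    by (rule card_image, rule inj_onI) (metis Int prod.inject singleton_inject)
  moreover have "bij_betw F (SIGMA K:Pow S. (S - K) \<rightarrow>\<^sub>E K) (weighted_partitions_on S)"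
    unfolding bij_betw_def
  proof
    show "inj_on F (SIGMA K:Pow S. (S - K) \<rightarrow>\<^sub>E K)"
    proof (rule inj_onI, clarify)
      fix K f K' f'
      assume K: "K \<subseteq> S" and f: "f \<in> (S - K) \<rightarrow>\<^sub>E K" and f': "f' \<in> (S - K') \<rightarrow>\<^sub>E K'"
        and eq: "F (K, f) = F (K', f')"
      have K': "K' = K" using root_F eq by metis
      have "f x = f' x" if x: "x \<in> S - K" for x
      proof -
        have fx: "f x \<in> K" using f x by auto
        then have "(block K f (f x), e (block K f (f x)) (f x)) \<in> F (K, f)"
          by (simp add: F_def)
        then have "(block K f (f x), e (block K f (f x)) (f x)) \<in> F (K, f')"
          unfolding eq K' .
        then obtain r where r: "r \<in> K" "block K f (f x) = block K f' r"
          unfolding F_def by blast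
        then have "f x = r" using Int[OF fx, of f] Int[OF r(1), of f'] by simp
        moreover have "x \<in> block K f (f x)" using x by (simp add: block_def)
        then have "x \<in> block K f' r" using r by simp
        then have "f' x = r" using x r(1) by (auto simp: block_def)
        ultimately show ?thesis by simp
      qed
      then show "K = K' \<and> f = f'"
        using f f' K' by (auto intro: PiE_ext)
    qed
    show "F ` (SIGMA K:Pow S. (S - K) \<rightarrow>\<^sub>E K) = weighted_partitions_on S"
    proof (intro equalityI subsetI)
      fix P assume "P \<in> F ` (SIGMA K:Pow S. (S - K) \<rightarrow>\<^sub>E K)"
      then obtain K f where K: "K \<subseteq> S" and f: "f \<in> (S - K) \<rightarrow>\<^sub>E K" and P: "P = F (K, f)" by auto
      have "block K f r \<subseteq> S" if "r \<in> K" for r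
        using that K by (auto simp: block_def)
      moreover have "e (block K f r) r < card (block K f r)" for r
        using bij_betwE[OF e[OF fin[of K f r]]] by (auto simp: block_def)
      moreover have "\<exists>!p. p \<in> P \<and> x \<in> fst p" if x: "x \<in> S" for x
      proof -
        define r where "r = (if x \<in> K then x else f x)"
        have "r \<in> K" using f x by (auto simp: r_def)
        moreover have "x \<in> block K f s \<longleftrightarrow> s = r" if "s \<in> K" for s
          using that x by (auto simp: block_def r_def)
        ultimately show ?thesis
          by (intro ex1I[of _ "(block K f r, e (block K f r) r)"]) (auto simp: P F_def)
      qed
      ultimately show "P \<in> weighted_partitions_on S"
        by (auto simp: weighted_partitions_on_iff P F_def)
    next
      fix P assume P: "P \<in> weighted_partitions_on S"
      define K where "K = root ` P"
      define p where "p x = (THE p. p \<in> P \<and> x \<in> fst p)" for x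
      define f where "f = (\<lambda>x\<in>S - K. root (p x))"
      have p: "p x \<in> P" "x \<in> fst (p x)" if "x \<in> S" for x
        using theI'[of "\<lambda>p. p \<in> P \<and> x \<in> fst p"] P that
        by (auto simp: weighted_partitions_on_iff p_def)
      have finq: "finite (fst q)" if "q \<in> P" for q
        using P S that by (auto simp: weighted_partitions_on_iff intro: finite_subset)
      have wq: "snd q \<in> e (fst q) ` fst q" if "q \<in> P" for q
        using P that e[OF finq[OF that]] by (auto simp: weighted_partitions_on_iff bij_betw_def)
      have rt: "root q \<in> fst q" "e (fst q) (root q) = snd q" if "q \<in> P" for q
        using wq[OF that] by (auto simp: root_def intro: inv_into_into f_inv_into_f)
      have sub: "fst q \<subseteq> S" if "q \<in> P" for q
        using P that by (auto simp: weighted_partitions_on_iff)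
      \<comment> \<open>Every root lies in its own block, so the only point of \<open>K\<close> in
        \<open>fst q\<close> is \<open>root q\<close>; the other points of \<open>fst q\<close> are
        exactly those that \<open>f\<close> sends there.\<close>
      have block: "block K f (root q) = fst q" if q: "q \<in> P" for q
      proof (intro equalityI subsetI)
        fix x assume x: "x \<in> block K f (root q)"
        show "x \<in> fst q"
        proof (cases "x = root q")
          case False
          then have x: "x \<in> S" "root (p x) = root q"
            using x by (auto simp: block_def f_def)
          then have "p x = q"
            using weighted_partition_unique[OF P p(1) q] rt(1)[OF q] rt(1)[OF p(1)] by metis
          then show ?thesis using p x by metis
        qed (use rt q in simp)
      next
        fix x assume x: "x \<in> fst q"
        then have xS: "x \<in> S" using sub[OF q] by blast
        show "x \<in> block K f (root q)"
        proof (cases "x \<in> K")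
          case True
          then obtain q' where "q' \<in> P" "x = root q'" by (auto simp: K_def)
          then show ?thesis
            using weighted_partition_unique[OF P q _ x] rt(1) by (auto simp: block_def)
        next
          case False
          have "p x = q" using weighted_partition_unique[OF P p(1) q p(2) x] xS by simp
          then show ?thesis using False xS by (simp add: block_def f_def)
        qed
      qed
      have "F (K, f) = P"
        using block rt(2) by (simp add: F_def K_def image_image)
      moreover have "K \<subseteq> S" using rt(1) sub by (fastforce simp: K_def)
      moreover have "f \<in> (S - K) \<rightarrow>\<^sub>E K" using p by (auto simp: f_def K_def)
      ultimately show "P \<in> F ` (SIGMA K:Pow S. (S - K) \<rightarrow>\<^sub>E K)"
        by (intro image_eqI[of _ _ "(K, f)"]) auto
    qed
  qed
  ultimately show ?thesis by (rule that[rotated])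
qed

text \<open>Group by the set of chosen points: if it has \<open>k\<close> elements, there are
  \<open>k ^ (card S - k)\<close> maps into it from its complement. At \<open>k = 0\<close> the
  convention \<open>0 ^ 0 = 1\<close> accounts for the empty partition of the empty set.\<close>

lemma sum_weighted_partitions_on:
  fixes h :: "nat \<Rightarrow> 'b::comm_semiring_1"
  assumes S: "finite S"
  shows "(\<Sum>P\<in>weighted_partitions_on S. h (card P))
    = (\<Sum>k\<le>card S. of_nat (card S choose k) * (of_nat k ^ (card S - k) * h k))"
proof -
  obtain F where F: "bij_betw F (SIGMA K:Pow S. (S - K) \<rightarrow>\<^sub>E K) (weighted_partitions_on S)"
    and card_F: "\<And>K f. card (F (K, f)) = card K"
    using weighted_partitions_on_bij[OF S] by blast
  have fin: "finite ((S - K) \<rightarrow>\<^sub>E K)" if "K \<in> Pow S" for K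
    using S that by (intro finite_PiE) (auto intro: finite_subset)
  have "(\<Sum>P\<in>weighted_partitions_on S. h (card P))
      = (\<Sum>(K, f)\<in>(SIGMA K:Pow S. (S - K) \<rightarrow>\<^sub>E K). h (card K))"
    by (subst sum.reindex_bij_betw[OF F, symmetric]) (auto simp: card_F intro!: sum.cong)
  also have "\<dots> = (\<Sum>K\<in>Pow S. \<Sum>f\<in>(S - K) \<rightarrow>\<^sub>E K. h (card K))"
    using S fin by (subst sum.Sigma) auto
  also have "\<dots> = (\<Sum>K\<in>Pow S. of_nat (card K) ^ (card S - card K) * h (card K))"
    using S by (intro sum.cong refl) (auto simp: card_PiE card_Diff_subset finite_subset)
  also have "\<dots> = (\<Sum>k\<le>card S. of_nat (card S choose k) * (of_nat k ^ (card S - k) * h k))"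
    using sum_Pow_card[OF S, of "\<lambda>k. of_nat k ^ (card S - k) * h k"] .
  finally show ?thesis .
qed

section \<open>The elements above a weighted partition\<close>

text \<open>A weighted block \<open>(B, v)\<close> of \<open>Q \<ge> P\<close> corresponds to the set of weighted blocks of \<open>P\<close> inside \<open>B\<close>,
  weighted by the excess of \<open>v\<close> over the sum of their weights.\<close>

lemma up_set_bij:
  assumes P: "P \<in> weighted_partitions n"
  obtains F where "bij_betw F (weighted_partitions_on P) {Q. (P, Q) \<in> weighted_partition_order n}"
    and "\<And>Q. Q \<in> weighted_partitions_on P \<Longrightarrow> card (F Q) = card Q"
proof -
  let ?S = "{1..n}"
  have PS: "P \<in> weighted_partitions_on ?S" using P by (simp add: weighted_partitions_eq)
  have wt: "fst p \<subseteq> ?S" "snd p < card (fst p)" if "p \<in> P" for p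
    using PS that by (auto simp: weighted_partitions_on_iff)
  have cover: "\<exists>p\<in>P. x \<in> fst p" if "x \<in> ?S" for x
    using PS that unfolding weighted_partitions_on_iff by blast
  have ne: "\<exists>x. x \<in> fst p" if "p \<in> P" for p
    using wt(2)[OF that] by (metis all_not_in_conv card.empty not_less_zero)
  define merge :: "(nat set \<times> nat) set \<times> nat \<Rightarrow> nat set \<times> nat"
    where "merge c = (\<Union> (fst ` fst c), snd c + sum snd (fst c))" for c
  \<comment> \<open>The subtraction is on naturals. It does not truncate on blocks of elements above
    \<open>P\<close>, by \<open>sum_le\<close> below.\<close>
  define split :: "nat set \<times> nat \<Rightarrow> (nat set \<times> nat) set \<times> nat"
    where "split b = (blocks_within P (fst b), snd b - sum snd (blocks_within P (fst b)))" for b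
  \<comment> \<open>A block of \<open>P\<close> inside the union has a point, and this point lies in
    a member of \<open>C\<close>, which must be that block.\<close>
  have within: "blocks_within P (\<Union> (fst ` C)) = C" if C: "C \<subseteq> P" for C
  proof (intro equalityI subsetI)
    fix p assume "p \<in> blocks_within P (\<Union> (fst ` C))"
    then have p: "p \<in> P" "fst p \<subseteq> \<Union> (fst ` C)" by (auto simp: blocks_within_def)
    then obtain x q where "x \<in> fst p" "q \<in> C" "x \<in> fst q" using ne by blast
    then show "p \<in> C" using weighted_partition_unique[OF PS] p C by blast
  qed (use C in \<open>auto simp: blocks_within_def\<close>)
  have split_merge: "split (merge c) = c" if "c \<in> Q" "Q \<in> weighted_partitions_on P" for c Q
  proof -
    have "fst c \<subseteq> P" using that by (auto simp: weighted_partitions_on_iff)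
    then show ?thesis by (simp add: split_def merge_def within)
  qed
  have up: "merge ` Q \<in> {R. (P, R) \<in> weighted_partition_order n}"
    if Q: "Q \<in> weighted_partitions_on P" for Q
  proof -
    have sub: "fst c \<subseteq> P" and lt: "snd c < card (fst c)" if "c \<in> Q" for c
      using Q that by (auto simp: weighted_partitions_on_iff)
    have coverQ: "\<exists>c\<in>Q. p \<in> fst c" if "p \<in> P" for p
      using Q that unfolding weighted_partitions_on_iff by blast
    have R: "merge ` Q \<in> weighted_partitions_on ?S"
      unfolding weighted_partitions_on_iff
    proof (intro conjI ballI)
      fix b assume "b \<in> merge ` Q"
      then obtain c where c: "c \<in> Q" "b = merge c" by auto
      show "fst b \<subseteq> ?S" using c sub[OF c(1)] wt(1) by (fastforce simp: merge_def)
      show "snd b < card (fst b)"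
        using weighted_partition_sum_le[OF PS _ sub[OF c(1)]] lt[OF c(1)] c(2) by (simp add: merge_def)
    next
      fix x assume "x \<in> ?S"
      then obtain p where p: "p \<in> P" "x \<in> fst p" using cover by blast
      then obtain c where c: "c \<in> Q" "p \<in> fst c" using coverQ by blast
      show "\<exists>!b. b \<in> merge ` Q \<and> x \<in> fst b"
      proof (rule ex1I[of _ "merge c"])
        fix b assume "b \<in> merge ` Q \<and> x \<in> fst b"
        then obtain c' p' where c': "c' \<in> Q" "b = merge c'" "p' \<in> fst c'" "x \<in> fst p'"
          by (auto simp: merge_def)
        then have "p' = p" using weighted_partition_unique[OF PS] p sub by blast
        then show "b = merge c" using weighted_partition_unique[OF Q, of c' c p] c c' by simp
      qed (use p c in \<open>auto simp: merge_def\<close>)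
    qed
    have "refines ?S (fst ` P) (fst ` merge ` Q)"
    proof -
      have "\<exists>b\<in>merge ` Q. fst p \<subseteq> fst b" if "p \<in> P" for p
        using coverQ[OF that] by (force simp: merge_def)
      then show ?thesis
        using PS R by (auto simp: refines_def weighted_partitions_on_def)
    qed
    \<comment> \<open>For \<open>merge c\<close> the difference is exactly \<open>snd c\<close> and
      the number of blocks is \<open>card (fst c)\<close>, so the order condition is the weight
      bound on \<open>c\<close>.\<close>
    moreover have "int v - (\<Sum>(A, w) \<in> blocks_within P B. int w)
            \<in> {0 .. int (card (blocks_within P B)) - 1}" if Bv: "(B, v) \<in> merge ` Q" for B v
    proof -
      obtain c where c: "(B, v) = merge c" "c \<in> Q" using Bv by (rule imageE)
      then have "B = \<Union> (fst ` fst c)" and v: "v = snd c + sum snd (fst c)"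
        by (simp_all add: merge_def)
      then have "blocks_within P B = fst c"
        using within[OF sub[OF c(2)]] by (simp only:)
      then show ?thesis using lt[OF c(2)] unfolding v by (simp add: case_prod_beta)
    qed
    ultimately show ?thesis
      using P R unfolding weighted_partition_order_def weighted_partitions_eq by blast
  qed
  have down: "split ` R \<in> weighted_partitions_on P" "merge ` split ` R = R"
    if PR: "(P, R) \<in> weighted_partition_order n" for R
  proof -
    have R: "R \<in> weighted_partitions_on ?S"
      using PR by (simp add: weighted_partition_order_def weighted_partitions_eq)
    have "refines ?S (fst ` P) (fst ` R)"
      using PR by (simp add: weighted_partition_order_def)
    then have ref: "\<exists>b\<in>R. fst p \<subseteq> fst b" if "p \<in> P" for p
      using that by (auto simp: refines_def)
    have "int (snd b) - (\<Sum>(A, w) \<in> blocks_within P (fst b). int w)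
            \<in> {0 .. int (card (blocks_within P (fst b))) - 1}" if "b \<in> R" for b
      using PR that by (force simp: weighted_partition_order_def)
    then have excess: "int (sum snd (blocks_within P (fst b))) \<le> int (snd b) \<and>
        int (snd b) - int (sum snd (blocks_within P (fst b))) < int (card (blocks_within P (fst b)))"
      if "b \<in> R" for b
      using that by (simp add: case_prod_beta)
    have sum_le: "sum snd (blocks_within P (fst b)) \<le> snd b" if "b \<in> R" for b
      using excess[OF that] by linarith
    have excess_lt: "snd b - sum snd (blocks_within P (fst b)) < card (blocks_within P (fst b))"
      if "b \<in> R" for b
      using excess[OF that] by linarith
    have same: "b = b'" if "b \<in> R" "b' \<in> R" "p \<in> P" "fst p \<subseteq> fst b" "fst p \<subseteq> fst b'" for b b' p
      using weighted_partition_unique[OF R] ne that by blast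
    show "split ` R \<in> weighted_partitions_on P"
      unfolding weighted_partitions_on_iff
    proof (intro conjI ballI)
      fix p assume p: "p \<in> P"
      then obtain b where b: "b \<in> R" "fst p \<subseteq> fst b" using ref by blast
      show "\<exists>!c. c \<in> split ` R \<and> p \<in> fst c"
      proof (rule ex1I[of _ "split b"])
        fix c assume "c \<in> split ` R \<and> p \<in> fst c"
        then obtain b' where "b' \<in> R" "c = split b'" "fst p \<subseteq> fst b'"
          by (auto simp: split_def blocks_within_def)
        then show "c = split b" using same b p by blast
      qed (use p b in \<open>auto simp: split_def blocks_within_def\<close>)
    next
      fix c assume "c \<in> split ` R"
      then obtain b where b: "b \<in> R" "c = split b" by blast
      show "fst c \<subseteq> P" by (auto simp: b split_def blocks_within_def)
      show "snd c < card (fst c)" using excess_lt[OF b(1)] by (simp add: b split_def)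
    qed
    have "merge (split b) = b" if b: "b \<in> R" for b
    proof -
      have "x \<in> \<Union> (fst ` blocks_within P (fst b))" if x: "x \<in> fst b" for x
      proof -
        have "x \<in> ?S" using R b x unfolding weighted_partitions_on_iff by blast
        then obtain p where p: "p \<in> P" "x \<in> fst p" using cover by blast
        \<comment> \<open>The block of \<open>R\<close> that contains \<open>fst p\<close> shares
          the point \<open>x\<close> with \<open>b\<close>, hence is \<open>b\<close>.\<close>
        then obtain b' where b': "b' \<in> R" "fst p \<subseteq> fst b'" using ref by blast
        then have "b' = b" using weighted_partition_unique[OF R _ b _ x] p by blast
        then have "p \<in> blocks_within P (fst b)"
          using p(1) b'(2) by (simp add: blocks_within_def case_prod_beta)
        then show ?thesis using p(2) by blast
      qed
      then have "\<Union> (fst ` blocks_within P (fst b)) = fst b"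
        by (auto simp: blocks_within_def)
      then show ?thesis using sum_le[OF b] by (simp add: merge_def split_def)
    qed
    then show "merge ` split ` R = R" by (simp add: image_image)
  qed
  have "split ` merge ` Q = Q" if "Q \<in> weighted_partitions_on P" for Q
    using split_merge[OF _ that] by (simp add: image_image)
  then have "bij_betw ((`) merge) (weighted_partitions_on P) {Q. (P, Q) \<in> weighted_partition_order n}"
    using up down by (intro bij_betw_byWitness[where f' = "(`) split"]) auto
  moreover have "card (merge ` Q) = card Q" if "Q \<in> weighted_partitions_on P" for Q
    using split_merge[OF _ that] by (intro card_image inj_on_inverseI[of _ split])
  ultimately show ?thesis by (rule that)
qed

section \<open>The Moebius value of the extended poset\<close>

theorem proposition2p6:
  fixes n :: nat
  assumes "n \<ge> 1"
  shows "moebius (adjoin_top (weighted_partition_order n)) (Some (weighted_partition_bot n)) None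
           = (-1) ^ n * (int n - 1) ^ (n - 1)"
proof -
  let ?r = "weighted_partition_order n" and ?b = "weighted_partition_bot n"
  \<comment> \<open>The guess for the value between an element with \<open>k\<close> blocks and the
    top. At \<open>k = 1\<close> it is -1, by \<open>0 ^ 0 = 1\<close>, as it must be for elements
    covered by the top.\<close>
  let ?h = "\<lambda>k. (-1) ^ k * (int k - 1) ^ (k - 1)"
  define g where "g z = (case z of None \<Rightarrow> 1 | Some P \<Rightarrow> ?h (card P))"
    for z :: "(nat set \<times> nat) set option"
  have Field: "Field (adjoin_top ?r) = insert None (Some ` weighted_partitions n)"
    by (simp add: Field_adjoin_top Field_weighted_partition_order)
  have bot: "?b \<in> weighted_partitions n"
  proof -
    \<comment> \<open>Membership of the bottom is read off from its lying below the one-block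
      partition of weight 0, whose block is nonempty by \<open>n \<ge> 1\<close>.\<close>
    have "{1..n} \<noteq> {}" using assms by simp
    then show ?thesis
      using weighted_partition_bot_least[of "{({1..n}, 0)}" n] partition_on_space[of "{1..n}"] assms
      by (auto simp: weighted_partition_order_def weighted_partitions_def)
  qed
  have "moebius (adjoin_top ?r) (Some ?b) None = g (Some ?b)"
  proof (rule moebius_eq_of_dual_recursion[OF partial_order_weighted_partition_hat])
    fix x assume "x \<in> Field (adjoin_top ?r)" "x \<noteq> None"
    then obtain P where x: "x = Some P" and P: "P \<in> weighted_partitions n"
      by (auto simp: Field)
    have PS: "P \<in> weighted_partitions_on {1..n}" using P by (simp add: weighted_partitions_eq)
    have fin: "finite P" using weighted_partition_finite[OF PS] by simp
    \<comment> \<open>Abel's identity will be applied with \<open>card P\<close> in place of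
      \<open>n\<close>, which has to be positive.\<close>
    have "P \<noteq> {}" using PS assms by (force simp: weighted_partitions_on_iff)
    then have pos: "card P > 0" using fin by (simp add: card_gt_0_iff)
    obtain F where F: "bij_betw F (weighted_partitions_on P) {Q. (P, Q) \<in> ?r}"
      and card_F: "\<And>Q. Q \<in> weighted_partitions_on P \<Longrightarrow> card (F Q) = card Q"
      using up_set_bij[OF P] by blast
    have "{z. (x, z) \<in> adjoin_top ?r} = insert None (Some ` {Q. (P, Q) \<in> ?r})"
      using P by (auto simp: x adjoin_top_def Field_weighted_partition_order)
    moreover have "finite {Q. (P, Q) \<in> ?r}"
      using finite_weighted_partitions[of n]
      by (rule finite_subset[rotated]) (auto simp: weighted_partition_order_def)
    \<comment> \<open>The adjoined top contributes 1, to be cancelled by the value -1 of Abel's sum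
      over the old elements above \<open>P\<close>.\<close>
    ultimately have "(\<Sum>z | (x, z) \<in> adjoin_top ?r. g z) = 1 + (\<Sum>Q | (P, Q) \<in> ?r. ?h (card Q))"
      by (simp add: g_def sum.reindex)
    also have "(\<Sum>Q | (P, Q) \<in> ?r. ?h (card Q)) = (\<Sum>Q\<in>weighted_partitions_on P. ?h (card Q))"
      by (subst sum.reindex_bij_betw[OF F, symmetric]) (auto simp: card_F intro!: sum.cong)
    also have "\<dots> = -1"
      using sum_weighted_partitions_on[OF fin, of ?h] abel_sum[OF pos] by simp
    finally show "(\<Sum>z | (x, z) \<in> adjoin_top ?r. g z) = 0" by simp
  next
    fix x assume "x \<in> Field (adjoin_top ?r)"
    then have "x \<in> insert None (Some ` weighted_partitions n)"
      by (simp only: Field)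
    then show "(Some ?b, x) \<in> adjoin_top ?r" "(x, None) \<in> adjoin_top ?r"
      using weighted_partition_bot_least bot
      by (auto simp: adjoin_top_def Field_weighted_partition_order)
  qed (auto simp: Field bot g_def finite_weighted_partitions)
  moreover have "card ?b = n"
    unfolding weighted_partition_bot_def by (subst card_image) (auto simp: inj_on_def)
  ultimately show ?thesis by (simp add: g_def)
qed

end
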